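(* Let $G$ be a finite noncyclic group (not necessarily abelian) of order $n$, and let $p$ be the smallest prime divisor of $n$. Then $$\mathsf d(G) \le \frac{n}{p} + 9p^2 - 10p.$$
   Context: Groups are written multiplicatively with identity $1$. A sequence over $G$ is a finite unordered list of elements of $G$ with repetitions allowed (an element of the free abelian monoid on $G$); its length is the number of terms counted with multiplicity. A sequence $S = g_1 \cdots g_\ell$ is one-product free if there is no nonempty subsequence $g_{i_1}, \dots, g_{i_k}$ ($k\ge 1$, distinct indices) and ordering of it whose product equals $1$. The small Davenport constant $\mathsf d(G)$ is the maximal integer $\ell$ such that there exists a one-product free sequence over $G$ of length $\ell$. *)

theory Defs
  imports "HOL-Algebra.Algebra" "HOL-Computational_Algebra.Primes" "HOL-Library.Multiset"
begin

definition list_product :: "('a, 'b) monoid_scheme \<Rightarrow> 'a list \<Rightarrow> 'a" where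
  "list_product G xs = foldr (\<otimes>\<^bsub>G\<^esub>) xs \<one>\<^bsub>G\<^esub>"

text \<open>Sequences over a group are unordered, so they are multisets over the carrier; an ordering of
  a subsequence \<open>T\<close> is a list \<open>xs\<close> with \<open>mset xs = T\<close>.\<close>

definition one_product_free :: "('a, 'b) monoid_scheme \<Rightarrow> 'a multiset \<Rightarrow> bool" where
  "one_product_free G S \<longleftrightarrow> set_mset S \<subseteq> carrier G \<and>
     \<not> (\<exists>T xs. T \<subseteq># S \<and> T \<noteq> {#} \<and> mset xs = T \<and> list_product G xs = \<one>\<^bsub>G\<^esub>)"

text \<open>\<open>Max\<close> is meaningful for finite groups: see \<open>one_product_free_lengths\<close> below.\<close>

definition small_davenport :: "('a, 'b) monoid_scheme \<Rightarrow> nat" where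
  "small_davenport G = Max {size S |S. one_product_free G S}"

lemma (in group) list_product_closed:
  "set xs \<subseteq> carrier G \<Longrightarrow> list_product G xs \<in> carrier G"
  by (induction xs) (auto simp: list_product_def)

lemma (in group) list_product_append:
  "set xs \<subseteq> carrier G \<Longrightarrow> set ys \<subseteq> carrier G \<Longrightarrow>
     list_product G (xs @ ys) = list_product G xs \<otimes> list_product G ys"
proof (induction xs)
  case Nil
  then show ?case using list_product_closed[of ys] by (simp add: list_product_def)
next
  case (Cons x xs)
  then have "list_product G xs \<in> carrier G" "list_product G ys \<in> carrier G"
    using list_product_closed by auto
  with Cons show ?case by (simp add: list_product_def m_assoc)
qed

lemma (in group) one_product_free_size_less:
  assumes fin: "finite (carrier G)" and S: "one_product_free G S"
  shows "size S < Coset.order G"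
proof -
  obtain ys where ys: "mset ys = S" using ex_mset by blast
  have car: "set ys \<subseteq> carrier G" using S ys by (auto simp: one_product_free_def)
  let ?f = "\<lambda>i. list_product G (take i ys)"
  have tk: "set (take i ys) \<subseteq> carrier G" for i using car set_take_subset[of i ys] by blast
  have ne: "?f i \<noteq> ?f j" if ij: "i < j" "j \<le> size S" for i j
  proof
    assume eq: "?f i = ?f j"
    let ?zs = "take (j - i) (drop i ys)"
    have split: "take j ys = take i ys @ ?zs"
      using ij by (metis le_add_diff_inverse less_imp_le take_add)
    have zc: "set ?zs \<subseteq> carrier G" using tk[of j] split by auto
    have "?f j = ?f i \<otimes> list_product G ?zs"
      using list_product_append[OF tk zc] split by metis
    then have "list_product G ?zs = \<one>"
      using eq list_product_closed[OF tk] list_product_closed[OF zc] by (metis l_cancel_one')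
    moreover have "mset ?zs \<subseteq># S"
    proof -
      have "ys = take i ys @ ?zs @ drop j ys"
        using split by (metis append_assoc append_take_drop_id)
      then have "S = mset (take i ys) + (mset ?zs + mset (drop j ys))"
        using ys by (metis mset_append)
      then show ?thesis
        by (metis mset_subset_eq_add_left subset_mset.add_increasing subset_mset.zero_le)
    qed
    moreover have "mset ?zs \<noteq> {#}"
      using ij ys by auto
    ultimately show False using S unfolding one_product_free_def by blast
  qed
  have "inj_on ?f {..size S}"
    by (rule inj_onI) (metis atMost_iff linorder_neqE_nat ne)
  moreover have "?f ` {..size S} \<subseteq> carrier G"
    using list_product_closed[OF tk] by auto
  ultimately have "card {..size S} \<le> card (carrier G)"
    using fin card_inj_on_le by blast
  then show ?thesis by (simp add: Coset.order_def)
qed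

lemma (in group) one_product_free_lengths:
  assumes "finite (carrier G)"
  shows "finite {size S |S. one_product_free G S}" "{size S |S. one_product_free G S} \<noteq> {}"
proof -
  show "finite {size S |S. one_product_free G S}"
    by (rule finite_subset[of _ "{..<Coset.order G}"])
       (use one_product_free_size_less[OF assms] in auto)
  have "one_product_free G {#}" by (auto simp: one_product_free_def)
  then show "{size S |S. one_product_free G S} \<noteq> {}" by blast
qed

end

theory Submission
  imports Defs
begin

text \<open>
  Let \<open>\<Sigma>(S)\<close> be the set of products of subsequences of \<open>S\<close>, the empty one included. By the
  Kemperman--Scherk inequality the deficit \<open>p|S| + 1 - |\<Sigma>(S)|\<close> is subadditive on decompositions of
  a one-product free \<open>S\<close>, and \<open>|\<Sigma>(S)| \<le> n\<close>, so it suffices to bound the deficit by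
  \<open>2p(p - 1) + 8p(p - 1)\<^sup>2\<close>. If fewer than \<open>p - 1\<close> terms lie outside some proper subgroup \<open>K\<close>, the
  theorem follows from \<open>|K| \<le> n/p\<close>. Otherwise move terms one by one from the remainder \<open>R\<close> into a
  part \<open>U\<close>, choosing them so that \<open>|\<Sigma>(U)|\<close> grows by at least \<open>p\<close>; by an argument of Olson this is
  possible as long as \<open>R\<close> generates the group and has at least \<open>8p\<close> distinct terms. The process
  ends in one of two ways. Either exactly \<open>p - 1\<close> terms of \<open>R\<close> are left outside a proper subgroup
  \<open>K\<close>: these spread \<open>\<Sigma>(R \<inter> K)\<close> over \<open>p\<close> cosets of \<open>K\<close>, which costs only \<open>(p - 1)\<^sup>2\<close>. Or \<open>R\<close> has fewer
  than \<open>8p\<close> distinct terms: then those of multiplicity at least \<open>p\<close> lie in fewer than \<open>8p\<close> maximal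
  cyclic subgroups, each of which is spread over \<open>p\<close> cosets by \<open>p - 1\<close> terms outside it.
\<close>

section \<open>Products of subsequences\<close>

text \<open>A list fixes a subsequence and its ordering at once; the empty list contributes the
  identity.\<close>

definition subprods :: "('a, 'b) monoid_scheme \<Rightarrow> 'a multiset \<Rightarrow> 'a set" where
  "subprods G S = list_product G ` {xs. mset xs \<subseteq># S}"

text \<open>The points that \<open>f\<close> adds to \<open>A\<close> are the images of the
  \<open>a\<close> with \<open>f a\<close> outside \<open>A\<close>. This serves both the averaging
  in \<open>card_set_mult_ge\<close> and the growth formula \<open>card_Un_shift\<close>.\<close>

lemma card_Un_image_inj:
  assumes "finite A" and "inj_on f A"
  shows "card (A \<union> f ` A) + card {a \<in> A. f a \<in> A} = 2 * card A"
proof -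
  have "A \<union> f ` A = A \<union> f ` {a \<in> A. f a \<notin> A}" by auto
  moreover have "card (A \<union> f ` {a \<in> A. f a \<notin> A}) = card A + card (f ` {a \<in> A. f a \<notin> A})"
    by (rule card_Un_disjoint) (use assms in auto)
  moreover have "card (f ` {a \<in> A. f a \<notin> A}) = card {a \<in> A. f a \<notin> A}"
    by (rule card_image) (use assms in \<open>auto simp: inj_on_def\<close>)
  moreover have "card A = card {a \<in> A. f a \<notin> A} + card {a \<in> A. f a \<in> A}"
    by (subst card_Un_disjoint[symmetric]) (use assms in \<open>auto intro!: arg_cong[of _ _ card]\<close>)
  ultimately show ?thesis by simp
qed

lemma obtain_submultiset_of_size:
  assumes "k \<le> size M"
  obtains N where "N \<subseteq># M" "size N = k"
proof -
  obtain xs where xs: "mset xs = M" using ex_mset by blast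
  have "mset (take k xs) \<subseteq># M"
    using xs by (metis append_take_drop_id mset_append mset_subset_eq_add_left)
  moreover have "size (mset (take k xs)) = k" using assms xs by auto
  ultimately show thesis by (rule that)
qed

lemma replicate_mset_subset_filter_mset:
  "n \<le> count M x \<Longrightarrow> P x \<Longrightarrow> replicate_mset n x \<subseteq># filter_mset P M"
  by (simp add: count_le_replicate_mset_subset_eq[symmetric])

context group
begin

lemma subprodsI: "mset xs \<subseteq># S \<Longrightarrow> list_product G xs \<in> subprods G S"
  by (auto simp: subprods_def)

lemma one_in_subprods [simp]: "\<one> \<in> subprods G S"
  using subprodsI[of "[]" S] by (simp add: list_product_def)

lemma subprods_mono: "S \<subseteq># T \<Longrightarrow> subprods G S \<subseteq> subprods G T"
  unfolding subprods_def using subset_mset.order_trans[of _ S T] by blast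

lemma subprods_subgroup:
  assumes "subgroup K G" and "set_mset S \<subseteq> K"
  shows "subprods G S \<subseteq> K"
proof -
  have "set xs \<subseteq> K \<Longrightarrow> list_product G xs \<in> K" for xs
    by (induction xs) (auto simp: list_product_def assms(1) subgroup.one_closed subgroup.m_closed)
  moreover have "mset xs \<subseteq># S \<Longrightarrow> set xs \<subseteq> K" for xs
    using assms(2) set_mset_mono by fastforce
  ultimately show ?thesis by (auto simp: subprods_def)
qed

lemma subprods_carrier: "set_mset S \<subseteq> carrier G \<Longrightarrow> subprods G S \<subseteq> carrier G"
  using subprods_subgroup[OF subgroup_self] .

lemma subprods_mult:
  assumes "set_mset (S + T) \<subseteq> carrier G" "x \<in> subprods G S" "y \<in> subprods G T"
  shows "x \<otimes> y \<in> subprods G (S + T)"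
proof -
  obtain xs ys where xs: "mset xs \<subseteq># S" "x = list_product G xs"
    and ys: "mset ys \<subseteq># T" "y = list_product G ys"
    using assms(2,3) by (auto simp: subprods_def)
  have "set xs \<subseteq> carrier G" "set ys \<subseteq> carrier G"
    using set_mset_mono[OF xs(1)] set_mset_mono[OF ys(1)] assms(1) by auto
  then have "x \<otimes> y = list_product G (xs @ ys)"
    by (simp add: xs ys list_product_append)
  then show ?thesis using subprodsI[of "xs @ ys"] xs(1) ys(1) by (simp add: subset_mset.add_mono)
qed

lemma subprods_mem: "x \<in># S \<Longrightarrow> x \<in> carrier G \<Longrightarrow> x \<in> subprods G S"
  using subprodsI[of "[x]" S] by (simp add: list_product_def)

lemma one_product_free_carrier: "one_product_free G S \<Longrightarrow> set_mset S \<subseteq> carrier G"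
  by (simp add: one_product_free_def)

lemma one_product_free_list:
  "one_product_free G S \<Longrightarrow> mset xs \<subseteq># S \<Longrightarrow> list_product G xs = \<one> \<Longrightarrow> xs = []"
  unfolding one_product_free_def by (metis mset_zero_iff)

lemma one_product_free_mono:
  "one_product_free G T \<Longrightarrow> S \<subseteq># T \<Longrightarrow> one_product_free G S"
  unfolding one_product_free_def using set_mset_mono[of S T]
  by (metis subset_mset.order_trans subset_trans)

text \<open>The concatenated lists have product one and use only terms of \<open>S + T\<close>, so
  they are empty. This is the uniqueness hypothesis of \<open>card_set_mult_ge\<close>.\<close>

lemma one_product_free_mult_eq_one:
  assumes "one_product_free G (S + T)" "x \<in> subprods G S" "y \<in> subprods G T" "x \<otimes> y = \<one>"
  shows "x = \<one>"
proof -
  obtain xs ys where xs: "mset xs \<subseteq># S" "x = list_product G xs"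
    and ys: "mset ys \<subseteq># T" "y = list_product G ys"
    using assms(2,3) by (auto simp: subprods_def)
  have "set xs \<subseteq> carrier G" "set ys \<subseteq> carrier G"
    using set_mset_mono[OF xs(1)] set_mset_mono[OF ys(1)] one_product_free_carrier[OF assms(1)]
    by auto
  then have "list_product G (xs @ ys) = \<one>"
    using assms(4) by (simp add: xs ys list_product_append)
  moreover have "mset (xs @ ys) \<subseteq># S + T" using xs(1) ys(1) by (simp add: subset_mset.add_mono)
  ultimately have "xs @ ys = []" using one_product_free_list[OF assms(1)] by blast
  then show ?thesis by (simp add: xs(2) list_product_def)
qed

text \<open>Induction on the transform that replaces \<open>(A, B)\<close> by \<open>(A \<union> Ae, B \<inter> e\<inverse>B)\<close> or by
  \<open>(A \<inter> Ae\<inverse>, B \<union> eB)\<close> for some \<open>e \<noteq> \<one>\<close> in \<open>A \<inter> B\<close>: both keep the product set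
  inside \<open>AB\<close>, and the two new cardinality sums average to the old one.\<close>

lemma card_set_mult_ge:
  assumes fin: "finite (carrier G)"
  shows "\<lbrakk>A \<subseteq> carrier G; B \<subseteq> carrier G; \<one> \<in> A; \<one> \<in> B;
      \<And>a b. \<lbrakk>a \<in> A; b \<in> B; a \<otimes> b = \<one>\<rbrakk> \<Longrightarrow> a = \<one>\<rbrakk>
    \<Longrightarrow> card A + card B \<le> card (A <#> B) + 1"
\<comment> \<open>A lexicographic measure: the cardinality sum grows, or it does not drop and
  \<open>card A\<close> grows. The weight dominates because \<open>card A\<close> is at most the
  order.\<close>
proof (induction "(2 * Coset.order G - (card A + card B)) * (Coset.order G + 1) + (Coset.order G - card A)"
    arbitrary: A B rule: less_induct)
  case less
  let ?n = "Coset.order G"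
  have finA: "finite A" and finB: "finite B"
    by (rule finite_subset[OF less.prems(1) fin], rule finite_subset[OF less.prems(2) fin])
  have le_n: "Y \<subseteq> carrier G \<Longrightarrow> card Y \<le> ?n" for Y
    using card_mono[OF fin, of Y] by (simp add: Coset.order_def)
  have finAB: "finite (A <#> B)"
    using finite_subset[OF set_mult_closed[OF less.prems(1,2)] fin] .
  show ?case
  proof (cases "A \<inter> B = {\<one>}")
    case True
    have "a \<otimes> \<one> \<in> A <#> B" if "a \<in> A" for a
      using that less.prems(4) unfolding set_mult_def by blast
    moreover have "\<one> \<otimes> b \<in> A <#> B" if "b \<in> B" for b
      using that less.prems(3) unfolding set_mult_def by blast
    ultimately have "A \<union> B \<subseteq> A <#> B" using less.prems(1,2) by fastforce
    then have "card (A \<union> B) \<le> card (A <#> B)" by (intro card_mono finAB)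
    then show ?thesis using card_Un_Int[OF finA finB] True by simp
  next
    case False
    then obtain e where e: "e \<in> A" "e \<in> B" "e \<noteq> \<one>" using less.prems(1-4) by blast
    have ec: "e \<in> carrier G" using e less.prems(1-4) by blast
    define A1 B1 A2 B2 where "A1 = A \<union> (\<lambda>a. a \<otimes> e) ` A" and "B1 = {b \<in> B. e \<otimes> b \<in> B}"
      and "A2 = {a \<in> A. a \<otimes> e \<in> A}" and "B2 = B \<union> (\<lambda>b. e \<otimes> b) ` B"
    have Ac: "a \<in> carrier G" if "a \<in> A" for a using that less.prems(1) by blast
    have Bc: "b \<in> carrier G" if "b \<in> B" for b using that less.prems(2) by blast
    have inj: "inj_on (\<lambda>a. a \<otimes> e) A" "inj_on (\<lambda>b. e \<otimes> b) B"
      by (auto intro!: inj_onI simp: Ac Bc ec)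
    have cA: "card A1 + card A2 = 2 * card A"
      unfolding A1_def A2_def by (rule card_Un_image_inj[OF finA inj(1)])
    have cB: "card B2 + card B1 = 2 * card B"
      unfolding B1_def B2_def by (rule card_Un_image_inj[OF finB inj(2)])
    have sub: "A1 \<subseteq> carrier G" "B1 \<subseteq> carrier G" "A2 \<subseteq> carrier G" "B2 \<subseteq> carrier G"
      using Ac Bc ec by (auto simp: A1_def B1_def A2_def B2_def)
    have one: "\<one> \<in> A1" "\<one> \<in> B1" "\<one> \<in> A2" "\<one> \<in> B2"
      using less.prems(3,4) e ec by (auto simp: A1_def B1_def A2_def B2_def)
    have u1: "a = \<one>" if ab: "a \<in> A1" "b \<in> B1" "a \<otimes> b = \<one>" for a b
    proof (rule ccontr)
      assume "a \<noteq> \<one>"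
      then have "a \<notin> A" using ab less.prems(5) by (auto simp: B1_def)
      then obtain a' where a': "a' \<in> A" "a = a' \<otimes> e" using ab by (auto simp: A1_def)
      have b: "e \<otimes> b \<in> B" "b \<in> B" using ab by (auto simp: B1_def)
      have "a' \<in> carrier G" "b \<in> carrier G" using a' b Ac Bc by auto
      then have "a' \<otimes> (e \<otimes> b) = \<one>" using ab(3) a' ec by (simp add: m_assoc)
      then have "a' = \<one>" using less.prems(5)[of a' "e \<otimes> b"] a' b by simp
      then show False using \<open>a \<notin> A\<close> a' e ec by simp
    qed
    have u2: "a = \<one>" if ab: "a \<in> A2" "b \<in> B2" "a \<otimes> b = \<one>" for a b
    proof (cases "b \<in> B")
      case True
      then show ?thesis using ab less.prems(5) by (auto simp: A2_def)
    next
      case False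
      then obtain b' where b': "b' \<in> B" "b = e \<otimes> b'" using ab by (auto simp: B2_def)
      have a: "a \<otimes> e \<in> A" "a \<in> A" using ab by (auto simp: A2_def)
      have "a \<in> carrier G" "b' \<in> carrier G" using a b' Ac Bc by auto
      then have "(a \<otimes> e) \<otimes> b' = \<one>" using ab(3) b' ec by (simp add: m_assoc)
      then have "a \<otimes> e = \<one>" using less.prems(5)[of "a \<otimes> e" b'] a b' by simp
      then show ?thesis using less.prems(5) a e by blast
    qed
    have s1: "A1 <#> B1 \<subseteq> A <#> B"
    proof
      fix z assume "z \<in> A1 <#> B1"
      then obtain a b where z: "a \<in> A1" "b \<in> B" "e \<otimes> b \<in> B" "z = a \<otimes> b"
        by (auto simp: set_mult_def B1_def)
      from z(1) consider "a \<in> A" | a' where "a' \<in> A" "a = a' \<otimes> e" by (auto simp: A1_def)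
      then show "z \<in> A <#> B"
      proof cases
        case 1
        then show ?thesis using z unfolding set_mult_def by blast
      next
        case 2
        then have "z = a' \<otimes> (e \<otimes> b)" using z Ac Bc ec by (simp add: m_assoc)
        then show ?thesis using z 2 unfolding set_mult_def by blast
      qed
    qed
    have s2: "A2 <#> B2 \<subseteq> A <#> B"
    proof
      fix z assume "z \<in> A2 <#> B2"
      then obtain a b where z: "b \<in> B2" "a \<in> A" "a \<otimes> e \<in> A" "z = a \<otimes> b"
        by (auto simp: set_mult_def A2_def)
      from z(1) consider "b \<in> B" | b' where "b' \<in> B" "b = e \<otimes> b'" by (auto simp: B2_def)
      then show "z \<in> A <#> B"
      proof cases
        case 1
        then show ?thesis using z unfolding set_mult_def by blast
      next
        case 2
        then have "z = (a \<otimes> e) \<otimes> b'" using z Ac Bc ec by (simp add: m_assoc)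
        then show ?thesis using z 2 unfolding set_mult_def by blast
      qed
    qed
    \<comment> \<open>If \<open>Ae\<close> stayed inside the finite set \<open>A\<close>, it would
      equal \<open>A\<close>, so \<open>ae = 1\<close> for some \<open>a\<close> in
      \<open>A\<close>; uniqueness gives \<open>a = 1\<close> and then \<open>e = 1\<close>.\<close>
    have A1_gt: "card A < card A1"
    proof -
      have "\<exists>a \<in> A. a \<otimes> e \<notin> A"
      proof (rule ccontr)
        assume "\<not> ?thesis"
        then have "(\<lambda>a. a \<otimes> e) ` A \<subseteq> A" by auto
        then have "(\<lambda>a. a \<otimes> e) ` A = A" using endo_inj_surj[OF finA _ inj(1)] by blast
        then obtain a where a: "a \<in> A" "a \<otimes> e = \<one>" using less.prems(3) by (metis imageE)
        then have "a = \<one>" using less.prems(5) e by blast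
        then show False using a e ec by simp
      qed
      then have "A \<subset> A1" by (auto simp: A1_def)
      then show ?thesis using finite_subset[OF sub(1) fin] by (simp add: psubset_card_mono)
    qed
    show ?thesis
    proof (cases "card A + card B \<le> card A1 + card B1")
      case True
      have "card A1 \<le> ?n" using le_n sub by blast
      then have m1: "?n - card A1 < ?n - card A" using A1_gt by simp
      have m2: "(2 * ?n - (card A1 + card B1)) * (?n + 1) \<le> (2 * ?n - (card A + card B)) * (?n + 1)"
        using True by (intro mult_right_mono) auto
      have "card A1 + card B1 \<le> card (A1 <#> B1) + 1"
        by (rule less.hyps[OF add_le_less_mono[OF m2 m1] sub(1,2) one(1,2) u1])
      then show ?thesis using True card_mono[OF finAB s1] by simp
    next
      case False
      then have gt: "card A + card B < card A2 + card B2" using cA cB by simp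
      moreover have "card A2 + card B2 \<le> 2 * ?n" using le_n[OF sub(3)] le_n[OF sub(4)] by simp
      ultimately have m1: "2 * ?n - (card A2 + card B2) + 1 \<le> 2 * ?n - (card A + card B)" by simp
      have "P * (k + 1) + a < Q * (k + 1) + b" if "P + 1 \<le> Q" "a \<le> k" for P Q a b k :: nat
        using mult_le_mono1[OF that(1), of "k + 1"] that(2) by (simp add: algebra_simps)
      note m2 = this[OF m1 diff_le_self]
      have "card A2 + card B2 \<le> card (A2 <#> B2) + 1"
        by (rule less.hyps[OF m2 sub(3,4) one(3,4) u2])
      then show ?thesis using gt card_mono[OF finAB s2] by simp
    qed
  qed
qed

text \<open>The Kemperman-Scherk inequality, as the product of the two sets lies in
  \<open>subprods G (S + T)\<close>.\<close>

lemma card_subprods_add: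
  assumes fin: "finite (carrier G)" and S: "one_product_free G (S + T)"
  shows "card (subprods G S) + card (subprods G T) \<le> card (subprods G (S + T)) + 1"
proof -
  have c: "set_mset (S + T) \<subseteq> carrier G" by (rule one_product_free_carrier[OF S])
  then have "subprods G S \<subseteq> carrier G" "subprods G T \<subseteq> carrier G"
    using subprods_carrier by auto
  then have "card (subprods G S) + card (subprods G T) \<le> card (subprods G S <#> subprods G T) + 1"
    using one_product_free_mult_eq_one[OF S] by (intro card_set_mult_ge fin) auto
  moreover have "subprods G S <#> subprods G T \<subseteq> subprods G (S + T)"
    using subprods_mult[OF c] by (auto simp: set_mult_def)
  moreover have "finite (subprods G (S + T))"
    using finite_subset[OF subprods_carrier[OF c] fin] .
  ultimately show ?thesis
    using card_mono[of "subprods G (S + T)" "subprods G S <#> subprods G T"] by linarith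
qed

text \<open>A single term brings two distinct products, so by \<open>card_subprods_add\<close> each
  term gains at least one.\<close>

lemma size_less_card_subprods:
  assumes fin: "finite (carrier G)"
  shows "one_product_free G S \<Longrightarrow> size S < card (subprods G S)"
proof (induction S)
  case empty
  have "finite (subprods G {#})" using finite_subset[OF subprods_carrier fin] by simp
  then have "card {\<one>} \<le> card (subprods G {#})" by (intro card_mono) auto
  then show ?case by simp
next
  case (add x S)
  have xc: "x \<in> carrier G" using one_product_free_carrier[OF add.prems] by simp
  have "x \<noteq> \<one>"
    using one_product_free_list[OF add.prems, of "[x]"] xc by (auto simp: list_product_def)
  moreover have "{\<one>, x} \<subseteq> subprods G {#x#}" using subprods_mem[of x "{#x#}"] xc by auto
  moreover have "finite (subprods G {#x#})"
    using finite_subset[OF subprods_carrier fin] xc by simp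
  ultimately have "2 \<le> card (subprods G {#x#})"
    using card_mono[of "subprods G {#x#}" "{\<one>, x}"] by simp
  moreover have "size S < card (subprods G S)"
    using add one_product_free_mono[of "add_mset x S" S] by simp
  ultimately show ?case using card_subprods_add[OF fin, of S "{#x#}"] add.prems by simp
qed

end

section \<open>Growth under right translation\<close>

text \<open>Olson's function of \<open>B\<close>: for finite \<open>B\<close> it is the growth from
  |B| to |B union Bx|, and the lemmas below make it a subadditive, symmetric length on the
  group.\<close>

definition displacement :: "('a, 'b) monoid_scheme \<Rightarrow> 'a set \<Rightarrow> 'a \<Rightarrow> nat" where
  "displacement G B x = card {b \<in> B. b \<otimes>\<^bsub>G\<^esub> x \<notin> B}"

context group
begin

lemma inj_on_mult_right: "B \<subseteq> carrier G \<Longrightarrow> x \<in> carrier G \<Longrightarrow> inj_on (\<lambda>b. b \<otimes> x) B"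
  by (meson inj_onI r_cancel subsetD)

lemma displacement_one [simp]: "B \<subseteq> carrier G \<Longrightarrow> displacement G B \<one> = 0"
  by (auto simp: displacement_def subset_iff intro!: card_eq_0_iff[THEN iffD2])

lemma card_eq_displacement:
  assumes "finite B"
  shows "card B = displacement G B x + card {b \<in> B. b \<otimes> x \<in> B}"
proof -
  have "B = {b \<in> B. b \<otimes> x \<notin> B} \<union> {b \<in> B. b \<otimes> x \<in> B}" by auto
  then show ?thesis unfolding displacement_def
    using card_Un_disjoint[of "{b \<in> B. b \<otimes> x \<notin> B}" "{b \<in> B. b \<otimes> x \<in> B}"] assms by fastforce
qed

lemma card_Un_shift:
  assumes "finite B" "B \<subseteq> carrier G" "x \<in> carrier G"
  shows "card (B \<union> (\<lambda>b. b \<otimes> x) ` B) = card B + displacement G B x"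
  using card_Un_image_inj[OF assms(1) inj_on_mult_right[OF assms(2,3)]]
    card_eq_displacement[OF assms(1), of x] by linarith

text \<open>An element pushed out by \<open>xy\<close> is pushed out by \<open>x\<close>, or its
  translate by \<open>x\<close> stays in \<open>B\<close> and is pushed out by
  \<open>y\<close>.\<close>

lemma displacement_mult:
  assumes "finite B" "B \<subseteq> carrier G" "x \<in> carrier G" "y \<in> carrier G"
  shows "displacement G B (x \<otimes> y) \<le> displacement G B x + displacement G B y"
proof -
  let ?D = "\<lambda>z. {b \<in> B. b \<otimes> z \<notin> B}"
  let ?E = "{b \<in> B. b \<otimes> x \<in> B \<and> b \<otimes> x \<otimes> y \<notin> B}"
  have "?D (x \<otimes> y) \<subseteq> ?D x \<union> ?E"
    using assms(2-4) by (auto simp: m_assoc subset_iff)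
  then have "card (?D (x \<otimes> y)) \<le> card (?D x \<union> ?E)" using assms(1) by (intro card_mono) auto
  also have "\<dots> \<le> card (?D x) + card ?E" by (rule card_Un_le)
  also have "card ?E \<le> card (?D y)"
    by (rule card_inj_on_le[of "\<lambda>b. b \<otimes> x"])
      (use assms inj_on_mult_right[OF assms(2,3)] in \<open>auto simp: inj_on_def\<close>)
  finally show ?thesis by (simp add: displacement_def)
qed

lemma displacement_inv:
  assumes "finite B" "B \<subseteq> carrier G" "x \<in> carrier G"
  shows "displacement G B (inv x) = displacement G B x"
proof -
  have c: "b \<otimes> x \<otimes> inv x = b" "b \<otimes> inv x \<otimes> x = b" if "b \<in> B" for b
    using that assms(2,3) by (auto simp: m_assoc subset_iff)
  have "bij_betw (\<lambda>b. b \<otimes> x) {b \<in> B. b \<otimes> x \<in> B} {b \<in> B. b \<otimes> inv x \<in> B}"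
    by (rule bij_betwI[where g = "\<lambda>b. b \<otimes> inv x"]) (auto simp: c)
  then show ?thesis
    using bij_betw_same_card card_eq_displacement[OF assms(1), of x]
      card_eq_displacement[OF assms(1), of "inv x"] by fastforce
qed

text \<open>What leaves the complement under \<open>x\<close> lands on an element of
  \<open>B\<close> that leaves \<open>B\<close> under \<open>inv x\<close>.\<close>

lemma displacement_compl:
  assumes "finite (carrier G)" "B \<subseteq> carrier G" "x \<in> carrier G"
  shows "displacement G (carrier G - B) x = displacement G B x"
proof -
  have c: "b \<otimes> x \<otimes> inv x = b" "b \<otimes> inv x \<otimes> x = b" if "b \<in> carrier G" for b
    using that assms(3) by (auto simp: m_assoc)
  have "bij_betw (\<lambda>b. b \<otimes> x) {b \<in> carrier G - B. b \<otimes> x \<notin> carrier G - B} {b \<in> B. b \<otimes> inv x \<notin> B}"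
    by (rule bij_betwI[where g = "\<lambda>b. b \<otimes> inv x"]) (use assms(2,3) in \<open>auto simp: c subset_iff\<close>)
  then have "displacement G (carrier G - B) x = displacement G B (inv x)"
    unfolding displacement_def by (rule bij_betw_same_card)
  then show ?thesis using displacement_inv assms finite_subset by metis
qed

text \<open>Double counting of the pairs \<open>(b, by)\<close> inside \<open>B\<close>: a pair
  determines \<open>y\<close>, and each \<open>y\<close> in \<open>Y\<close> yields at least
  \<open>card B - d\<close> of them.\<close>

lemma card_mult_displacement_le:
  assumes fin: "finite B" and sub: "B \<subseteq> carrier G" and Y: "finite Y" "Y \<subseteq> carrier G"
    and d: "\<And>y. y \<in> Y \<Longrightarrow> displacement G B y \<le> d"
  shows "card Y * (card B - d) \<le> card B * card B"
proof -
  have "card Y * (card B - d) = (\<Sum>y\<in>Y. card B - d)" by simp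
  also have "\<dots> \<le> (\<Sum>y\<in>Y. card {b \<in> B. b \<otimes> y \<in> B})"
  proof (rule sum_mono)
    fix y assume "y \<in> Y"
    then show "card B - d \<le> card {b \<in> B. b \<otimes> y \<in> B}"
      using d[of y] card_eq_displacement[OF fin, of y] by linarith
  qed
  also have "\<dots> = card (SIGMA y:Y. {b \<in> B. b \<otimes> y \<in> B})"
    using Y fin by simp
  also have "\<dots> \<le> card (B \<times> B)"
  proof (rule card_inj_on_le[of "\<lambda>(y, b). (b, b \<otimes> y)"])
    show "inj_on (\<lambda>(y, b). (b, b \<otimes> y)) (SIGMA y:Y. {b \<in> B. b \<otimes> y \<in> B})"
      using sub Y(2) by (auto simp: inj_on_def subset_iff)
  qed (use fin in auto)
  finally show ?thesis by (simp add: card_cartesian_product)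
qed

text \<open>Meant for a level set of the displacement that stops growing: \<open>T\<close> generates
  the group, so a set closed under its translations contains every word in \<open>T\<close>.\<close>

lemma right_closed_eq_carrier:
  assumes T: "T \<subseteq> carrier G" "\<And>x. x \<in> T \<Longrightarrow> inv x \<in> T"
    and gen: "\<And>K. subgroup K G \<Longrightarrow> T \<subseteq> K \<Longrightarrow> K = carrier G"
    and Z: "Z \<subseteq> carrier G" "\<one> \<in> Z" "\<And>z x. z \<in> Z \<Longrightarrow> x \<in> T \<Longrightarrow> z \<otimes> x \<in> Z"
  shows "Z = carrier G"
proof -
  have "\<forall>z\<in>Z. z \<otimes> h \<in> Z" if "h \<in> generate G T" for h
    using that
  proof (induction rule: generate.induct)
    case (eng h1 h2)
    then have "h1 \<in> carrier G" "h2 \<in> carrier G"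
      using generate_in_carrier[OF T(1)] by auto
    then show ?case using eng.IH Z(1) by (auto simp: m_assoc[symmetric] subset_iff)
  qed (use T Z in \<open>auto simp: subset_iff\<close>)
  moreover have "generate G T = carrier G"
    using gen[OF generate_is_subgroup[OF T(1)]] generate.incl[of _ T G] by blast
  ultimately have "carrier G \<subseteq> Z" using Z(2) by force
  then show ?thesis using Z(1) by blast
qed

text \<open>If \<open>Z (j + 2) \<noteq> Z (j + 1)\<close> for the level sets \<open>Z\<close> below, then \<open>Z (j + 3)\<close> contains a
  translate of \<open>T\<close> disjoint from \<open>Z j\<close>.\<close>

lemma card_displacement_level_ge:
  assumes fin: "finite (carrier G)" and B: "B \<subseteq> carrier G"
    and T: "T \<subseteq> carrier G" "\<one> \<in> T" "\<And>x. x \<in> T \<Longrightarrow> inv x \<in> T"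
    and gen: "\<And>K. subgroup K G \<Longrightarrow> T \<subseteq> K \<Longrightarrow> K = carrier G"
    and t: "\<And>x. x \<in> T \<Longrightarrow> displacement G B x \<le> t"
  defines "Z \<equiv> \<lambda>j. {y \<in> carrier G. displacement G B y \<le> j * t}"
  shows "Z (3 * i + 1) = carrier G \<or> (i + 1) * card T \<le> card (Z (3 * i + 1))"
proof -
  have finB: "finite B" using B fin finite_subset by blast
  have finZ: "finite (Z j)" for j using fin by (simp add: Z_def)
  have Zc: "Z j \<subseteq> carrier G" and Z1: "\<one> \<in> Z j" for j using B by (auto simp: Z_def)
  have step: "y \<otimes> x \<in> Z (Suc j)" if "y \<in> Z j" "x \<in> T" for y x j
  proof -
    have "displacement G B (y \<otimes> x) \<le> j * t + t"
      using displacement_mult[OF finB B, of y x] that t[of x] T(1) by (fastforce simp: Z_def)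
    then show ?thesis using that T(1) by (auto simp: Z_def)
  qed
  have mono: "Z j \<subseteq> Z k" if "j \<le> k" for j k
    using le_trans[OF _ mult_le_mono1[OF that, of t]] unfolding Z_def by blast
  show ?thesis
  proof (induction i)
    case 0
    have "T \<subseteq> Z 1" using T(1) t by (auto simp: Z_def)
    then show ?case using card_mono[OF finZ] by simp
  next
    case (Suc i)
    let ?j = "3 * i + 1"
    show ?case
    proof (cases "Z (Suc (Suc ?j)) = Z (Suc ?j)")
      case True
      then have "Z (Suc ?j) = carrier G"
        using right_closed_eq_carrier[OF T(1,3) gen Zc Z1] step by blast
      then have "Z (3 * Suc i + 1) = carrier G"
        using mono[of "Suc ?j" "3 * Suc i + 1"] Zc[of "3 * Suc i + 1"] by auto
      then show ?thesis ..
    next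
      case False
      then obtain y where y: "y \<in> Z (Suc (Suc ?j))" "y \<notin> Z (Suc ?j)"
        using mono[of "Suc ?j" "Suc (Suc ?j)"] by auto
      then have yc: "y \<in> carrier G" using Zc by auto
      \<comment> \<open>If \<open>yx\<close> lay in \<open>Z ?j\<close>, undoing \<open>x\<close>
        would put \<open>y\<close> into the next level, which it avoids.\<close>
      have disj: "Z ?j \<inter> (\<lambda>x. y \<otimes> x) ` T = {}"
      proof (rule ccontr)
        assume "\<not> ?thesis"
        then obtain x where x: "x \<in> T" "y \<otimes> x \<in> Z ?j" by auto
        then have "y \<otimes> x \<otimes> inv x \<in> Z (Suc ?j)" using step T(3) by blast
        then show False using y yc x T(1) by (auto simp: m_assoc subset_iff)
      qed
      have "(\<lambda>x. y \<otimes> x) ` T \<subseteq> Z (3 * Suc i + 1)"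
        using step[OF y(1)] by (auto simp: numeral_3_eq_3)
      then have "Z ?j \<union> (\<lambda>x. y \<otimes> x) ` T \<subseteq> Z (3 * Suc i + 1)"
        using mono[of ?j "3 * Suc i + 1"] by auto
      then have "card (Z ?j \<union> (\<lambda>x. y \<otimes> x) ` T) \<le> card (Z (3 * Suc i + 1))"
        by (rule card_mono[OF finZ])
      moreover have "card (Z ?j \<union> (\<lambda>x. y \<otimes> x) ` T) = card (Z ?j) + card ((\<lambda>x. y \<otimes> x) ` T)"
        using finZ finite_subset[OF T(1) fin] disj by (intro card_Un_disjoint) auto
      moreover have "card ((\<lambda>x. y \<otimes> x) ` T) = card T"
        using T(1) yc by (intro card_image) (auto simp: inj_on_def subset_iff)
      ultimately have ge: "card (Z ?j) + card T \<le> card (Z (3 * Suc i + 1))" by simp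
      show ?thesis
      proof (cases "Z ?j = carrier G")
        case True
        then show ?thesis using mono[of ?j "3 * Suc i + 1"] Zc[of "3 * Suc i + 1"] by auto
      next
        case False
        then have "(i + 1) * card T \<le> card (Z ?j)" using Suc.IH by blast
        then show ?thesis using ge by simp
      qed
    qed
  qed
qed

text \<open>If no element of \<open>T\<close> works, level sets are large by
  \<open>card_displacement_level_ge\<close>, while double counting leaves fewer than 2|B| elements
  at a level below |B|/2. The two bounds collide at the last such level.\<close>

lemma ex_large_displacement:
  assumes fin: "finite (carrier G)" and B: "B \<subseteq> carrier G"
    and T: "T \<subseteq> carrier G" "\<one> \<in> T" "\<And>x. x \<in> T \<Longrightarrow> inv x \<in> T"
    and gen: "\<And>K. subgroup K G \<Longrightarrow> T \<subseteq> K \<Longrightarrow> K = carrier G"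
    and t: "0 < t" "2 * t < card B" "2 * t < card (carrier G - B)" "16 * t \<le> card T"
  shows "\<exists>x\<in>T. t < displacement G B x"
proof -
  \<comment> \<open>With \<open>B\<close> at most half of the group, fewer than 2|B| elements cannot
    be the whole group; a larger \<open>B\<close> is replaced by its complement.\<close>
  have half: "\<exists>x\<in>T. t < displacement G B x"
    if B: "B \<subseteq> carrier G" and b: "2 * card B \<le> card (carrier G)" "2 * t < card B" for B
  proof (rule ccontr)
    assume "\<not> ?thesis"
    then have le: "displacement G B x \<le> t" if "x \<in> T" for x using that by (meson not_le)
    let ?b = "card B"
    \<comment> \<open>This picks the last level \<open>(3 * i + 1) * t\<close> below |B|/2;
      \<open>i = 0\<close> qualifies and the levels are unbounded.\<close>
    have "\<exists>i. 2 * (3 * i + 1) * t < ?b \<and> \<not> 2 * (3 * (i + 1) + 1) * t < ?b"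
    proof (rule ccontr)
      assume "\<not> ?thesis"
      then have "2 * (3 * i + 1) * t < ?b" for i
        using b(2) by (induction i) auto
      from this[of ?b] have "2 * (3 * ?b + 1) * t < ?b" .
      moreover have "2 * (3 * ?b + 1) * 1 \<le> 2 * (3 * ?b + 1) * t"
        using t(1) by (intro mult_le_mono2) simp
      ultimately show False by simp
    qed
    then obtain i where i: "2 * ((3 * i + 1) * t) < ?b" "?b \<le> 2 * (3 * (i + 1) + 1) * t"
      by (auto simp: mult.assoc not_less)
    define Z where "Z = {y \<in> carrier G. displacement G B y \<le> (3 * i + 1) * t}"
    have "card Z * (?b - (3 * i + 1) * t) \<le> ?b * ?b"
      by (rule card_mult_displacement_le)
        (use fin B finite_subset in \<open>auto simp: Z_def\<close>)
    then have "card Z * (2 * (?b - (3 * i + 1) * t)) \<le> ?b * (2 * ?b)" by simp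
    moreover have "card Z * (?b + 1) \<le> card Z * (2 * (?b - (3 * i + 1) * t))"
      using i(1) by (intro mult_le_mono2) simp
    ultimately have Zb: "card Z * (?b + 1) \<le> 2 * ?b * ?b" by simp
    have small: "card Z < 2 * ?b"
    proof (rule ccontr)
      assume "\<not> ?thesis"
      then have "2 * ?b * (?b + 1) \<le> card Z * (?b + 1)" by (intro mult_le_mono1) simp
      then show False using Zb b(2) by simp
    qed
    \<comment> \<open>The constant 16 comes from 2|B| <= (12i + 16)t <= 16(i + 1)t <= |Z|, against
      \<open>small\<close>.\<close>
    have "(i + 1) * (16 * t) \<le> (i + 1) * card T" using t(4) by (intro mult_le_mono2)
    moreover have "(i + 1) * card T \<le> card Z"
      using card_displacement_level_ge[OF fin B T gen le, of i] small b(1) unfolding Z_def by auto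
    ultimately show False using small i(2) by (simp add: algebra_simps)
  qed
  show ?thesis
  proof (cases "2 * card B \<le> card (carrier G)")
    case True
    then show ?thesis using half[OF B] t by blast
  next
    case False
    then have "2 * card (carrier G - B) \<le> card (carrier G)"
      using card_Diff_subset[OF finite_subset[OF B fin] B] by simp
    then obtain x where x: "x \<in> T" "t < displacement G (carrier G - B) x"
      using half[of "carrier G - B"] t(3) by blast
    then have "displacement G (carrier G - B) x = displacement G B x"
      using displacement_compl[OF fin B] T(1) by blast
    then show ?thesis using x by auto
  qed
qed

end

section \<open>Deficits\<close>

no_notation (ASCII) subset_mset (infix "<#" 50)

text \<open>The bound on prime divisors acts twice: positive exponents below \<open>p\<close> are
  coprime to the order, and proper subgroups have index at least \<open>p\<close>.\<close>

locale least_prime_group = group G for G (structure) +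
  fixes p :: nat
  assumes finite_carrier: "finite (carrier G)"
    and p_gt_1: "1 < p"
    and p_le: "\<And>q. Factorial_Ring.prime q \<Longrightarrow> q dvd Coset.order G \<Longrightarrow> p \<le> q"
begin

text \<open>The summand 1 absorbs the loss of one in \<open>card_subprods_add\<close>, which gives
  subadditivity. The value may be negative, hence the integers.\<close>

definition deficit :: "'a multiset \<Rightarrow> int" where
  "deficit S = int p * int (size S) + 1 - int (card (subprods G S))"

lemma deficit_add: "one_product_free G (S + T) \<Longrightarrow> deficit (S + T) \<le> deficit S + deficit T"
  using card_subprods_add[OF finite_carrier, of S T] by (simp add: deficit_def algebra_simps)

lemma deficit_le_size: "one_product_free G S \<Longrightarrow> deficit S \<le> (int p - 1) * int (size S)"
  using size_less_card_subprods[OF finite_carrier, of S] by (simp add: deficit_def algebra_simps)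

section \<open>Spreading over the cosets of a subgroup\<close>

lemma subgroup_mem_of_small_power:
  assumes K: "subgroup K G" and h: "h \<in> carrier G" and d: "0 < d" "d < p" "h [^] d \<in> K"
  shows "h \<in> K"
proof -
  have "Rings.coprime d (Coset.order G)"
  proof (rule ccontr)
    assume "\<not> ?thesis"
    then obtain q where "Factorial_Ring.prime q" "q dvd d" "q dvd Coset.order G"
      using prime_factor_nat[of "gcd d (Coset.order G)"] by (auto simp: coprime_iff_gcd_eq_1)
    then show False using p_le[of q] dvd_imp_le[of q d] d by linarith
  qed
  \<comment> \<open>By Bezout \<open>h\<close> is the \<open>a\<close>-th power of
    \<open>h [^] d\<close>, as the order annihilates \<open>h\<close>.\<close>
  then obtain a b where ab: "d * a = Coset.order G * b + 1"
    using bezout_nat[of d "Coset.order G"] d(1) by auto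
  have "(h [^] d) [^] a = h"
    using h by (simp add: nat_pow_pow ab nat_pow_mult[symmetric] nat_pow_pow[symmetric]
        pow_order_eq_1 nat_pow_one)
  moreover have "x \<in> K \<Longrightarrow> x [^] a \<in> K" for x and a :: nat
    by (induction a) (auto simp: subgroup.one_closed[OF K] subgroup.m_closed[OF K])
  ultimately show ?thesis using d(3) by metis
qed

text \<open>Each further term reaches a new coset: its powers start in \<open>K\<close> and must
  leave the represented cosets at some point.\<close>

lemma ex_coset_transversal:
  assumes K: "subgroup K G"
  shows "set hs \<subseteq> carrier G - K \<Longrightarrow> length hs < p \<Longrightarrow>
    \<exists>Q \<subseteq> subprods G (mset hs). \<one> \<in> Q \<and> card Q = Suc (length hs) \<and> inj_on (\<lambda>q. q <# K) Q"
proof (induction hs)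
  case Nil
  then show ?case by (intro exI[of _ "{\<one>}"]) auto
next
  case (Cons h hs)
  have Kc: "K \<subseteq> carrier G" by (rule subgroup.subset[OF K])
  have h: "h \<in> carrier G" "h \<notin> K" using Cons.prems by auto
  obtain Q where Q: "Q \<subseteq> subprods G (mset hs)" "\<one> \<in> Q" "card Q = Suc (length hs)"
    "inj_on (\<lambda>q. q <# K) Q"
    using Cons by auto
  have finQ: "finite Q" using Q(3) card.infinite by fastforce
  have Qc: "Q \<subseteq> carrier G" using Q(1) subprods_carrier[of "mset hs"] Cons.prems(1) by auto
  let ?C = "(\<lambda>q. q <# K) ` Q" and ?f = "\<lambda>i::nat. h [^] i <# K"
  have cardC: "card ?C = Suc (length hs)" using card_image[OF Q(4)] Q(3) by simp
  \<comment> \<open>Otherwise the cosets of the first \<open>length hs + 2\<close> powers of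
    \<open>h\<close> would be among \<open>length hs + 1\<close> represented ones; two agree, and a
    positive power of \<open>h\<close> with exponent below \<open>p\<close> lies in
    \<open>K\<close>.\<close>
  have "\<exists>i. ?f i \<in> ?C \<and> ?f (Suc i) \<notin> ?C"
  proof (rule ccontr)
    assume *: "\<not> ?thesis"
    have "?f i \<in> ?C" for i
    proof (induction i)
      case 0
      then show ?case using Q(2) by auto
    next
      case (Suc i)
      then show ?case using * by blast
    qed
    then have "?f ` {..Suc (length hs)} \<subseteq> ?C" by blast
    then have "card (?f ` {..Suc (length hs)}) \<le> card ?C"
      by (rule card_mono[OF finite_imageI[OF finQ]])
    then have "\<not> inj_on ?f {..Suc (length hs)}" by (intro pigeonhole) (simp add: cardC)
    then obtain i j where ij: "i < j" "j \<le> Suc (length hs)" "?f i = ?f j"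
      using linorder_inj_onI'[of "{..Suc (length hs)}" ?f] by auto
    have "h [^] j \<in> ?f j"
      by (rule lcos_self[OF nat_pow_closed[OF h(1)] K])
    then obtain k where k: "k \<in> K" "h [^] j = h [^] i \<otimes> k"
      using ij(3) by (auto simp: l_coset_def)
    moreover have "h [^] j = h [^] i \<otimes> h [^] (j - i)"
      using ij(1) h(1) by (simp add: nat_pow_mult)
    ultimately have "h [^] (j - i) = k" using h(1) Kc by (metis l_cancel nat_pow_closed subsetD)
    then have "h \<in> K"
      using subgroup_mem_of_small_power[OF K h(1), of "j - i"] ij k Cons.prems(2) by simp
    then show False using h by simp
  qed
  then obtain i q where i: "?f (Suc i) \<notin> ?C" "q \<in> Q" "?f i = q <# K" by auto
  have qc: "q \<in> carrier G" using i Qc by blast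
  have "h \<otimes> q <# K = h <# (q <# K)" using h qc Kc by (simp add: lcos_m_assoc)
  also have "\<dots> = h \<otimes> h [^] i <# K" using h Kc by (simp add: i(3)[symmetric] lcos_m_assoc)
  also have "\<dots> = ?f (Suc i)" using h by (simp add: nat_pow_Suc2[symmetric])
  finally have new: "h \<otimes> q <# K \<notin> ?C" using i(1) by simp
  have hq: "h \<otimes> q \<in> subprods G (mset (h # hs))"
    using subprods_mult[of "{#h#}" "mset hs" h q] subprods_mem[of h "{#h#}"] i(2) Q(1) Cons.prems(1)
    by auto
  have "subprods G (mset hs) \<subseteq> subprods G (mset (h # hs))" by (rule subprods_mono) simp
  then have "insert (h \<otimes> q) Q \<subseteq> subprods G (mset (h # hs))" using hq Q(1) by blast
  moreover have "card (insert (h \<otimes> q) Q) = Suc (length (h # hs))"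
    using new finQ Q(3) by (subst card_insert_disjoint) auto
  moreover have "inj_on (\<lambda>q. q <# K) (insert (h \<otimes> q) Q)"
    using new Q(4) by (auto simp: inj_on_insert)
  ultimately show ?case using Q(2) by blast
qed

text \<open>\<open>E\<close> has products in \<open>p\<close> distinct cosets of \<open>K\<close>,
  and \<open>subprods G A\<close> stays inside \<open>K\<close>, so its translates by them are
  disjoint.\<close>

lemma mult_card_subprods_le:
  assumes K: "subgroup K G" and A: "set_mset A \<subseteq> K"
    and E: "set_mset E \<subseteq> carrier G - K" "Suc (size E) = p"
  shows "p * card (subprods G A) \<le> card (subprods G (A + E))"
proof -
  have Kc: "K \<subseteq> carrier G" by (rule subgroup.subset[OF K])
  obtain hs where hs: "mset hs = E" using ex_mset by blast
  then obtain Q where Q: "Q \<subseteq> subprods G E" "card Q = p" "inj_on (\<lambda>q. q <# K) Q"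
    using ex_coset_transversal[OF K, of hs] E by auto
  have Qc: "Q \<subseteq> carrier G" using Q(1) subprods_carrier[of E] E(1) by auto
  have AK: "subprods G A \<subseteq> K" by (rule subprods_subgroup[OF K A])
  have EA: "set_mset (E + A) \<subseteq> carrier G" using E A Kc by auto
  have coset: "q \<otimes> a <# K = q <# K" if "q \<in> Q" "a \<in> subprods G A" for q a
  proof -
    have "q \<otimes> a <# K = q <# (a <# K)" using that Qc AK Kc by (simp add: lcos_m_assoc subset_iff)
    also have "a <# K = K" using that AK Kc K by (intro coset_join3) auto
    finally show ?thesis .
  qed
  have "inj_on (\<lambda>(q, a). q \<otimes> a) (Q \<times> subprods G A)"
  proof (rule inj_onI, clarify)
    fix q a q' a'
    assume asm: "q \<in> Q" "a \<in> subprods G A" "q' \<in> Q" "a' \<in> subprods G A" "q \<otimes> a = q' \<otimes> a'"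
    then have "q <# K = q' <# K" using coset by metis
    then have "q = q'" using Q(3) asm by (meson inj_onD)
    moreover have "a = a'" using asm calculation Qc AK Kc by (metis l_cancel subsetD)
    ultimately show "q = q' \<and> a = a'" by simp
  qed
  moreover have "(\<lambda>(q, a). q \<otimes> a) ` (Q \<times> subprods G A) \<subseteq> subprods G (E + A)"
    using subprods_mult[OF EA] Q(1) by auto
  moreover have "finite (subprods G (E + A))"
    using finite_subset[OF subprods_carrier[OF EA] finite_carrier] .
  ultimately have "card (Q \<times> subprods G A) \<le> card (subprods G (E + A))"
    by (rule card_inj_on_le)
  then show ?thesis by (simp add: card_cartesian_product Q(2) add.commute)
qed

text \<open>At least \<open>p(|A| + 1)\<close> products pay for all of \<open>A\<close>; what
  remains is \<open>p(p - 1) + 1 - p\<close>.\<close>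

lemma deficit_coset_block:
  assumes S: "one_product_free G (A + E)" and K: "subgroup K G" and A: "set_mset A \<subseteq> K"
    and E: "set_mset E \<inter> K = {}" "size E = p - 1"
  shows "deficit (A + E) \<le> (int p - 1)\<^sup>2"
proof -
  have "set_mset E \<subseteq> carrier G - K" using E one_product_free_carrier[OF S] by auto
  then have "p * card (subprods G A) \<le> card (subprods G (A + E))"
    using mult_card_subprods_le[OF K A] E(2) p_gt_1 by simp
  moreover have "p * (size A + 1) \<le> p * card (subprods G A)"
    using size_less_card_subprods[OF finite_carrier one_product_free_mono[OF S, of A]]
    by (intro mult_le_mono2) simp
  ultimately have "int (p * (size A + 1)) \<le> int (card (subprods G (A + E)))" by linarith
  then show ?thesis using E(2) p_gt_1
    by (simp add: deficit_def of_nat_diff algebra_simps power2_eq_square)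
qed


text \<open>\<open>E\<close> spreads the terms in the cyclic subgroup except for
  \<open>p - 1\<close> copies of \<open>g\<close>, which are held back to spread the remaining terms
  later.\<close>

lemma deficit_cyclic_block:
  assumes S: "one_product_free G (R + E)" and E: "size E = p - 1"
    and g: "p - 1 \<le> count R g" "set_mset E \<inter> generate G {g} = {}"
  shows "deficit (R + E) \<le> (int p - 1)\<^sup>2
    + deficit (filter_mset (\<lambda>x. x \<notin> generate G {g}) R + replicate_mset (p - 1) g)"
proof -
  let ?K = "generate G {g}"
  let ?I = "filter_mset (\<lambda>x. x \<in> ?K) R" and ?O = "filter_mset (\<lambda>x. x \<notin> ?K) R"
    and ?g = "replicate_mset (p - 1) g"
  have "0 < count R g" using g(1) p_gt_1 by linarith
  then have gc: "g \<in> carrier G" using one_product_free_carrier[OF S] by auto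
  have "?g \<subseteq># ?I" using g(1) by (intro replicate_mset_subset_filter_mset) (simp_all add: generate.incl)
  then obtain F where F: "?I = ?g + F" by (metis subset_mset.le_iff_add)
  have eq: "R + E = (F + E) + (?O + ?g)"
    using multiset_partition[of R "\<lambda>x. x \<in> ?K"] F by (simp add: ac_simps)
  have "set_mset F \<subseteq> ?K" using arg_cong[OF F, of set_mset] by auto
  moreover have "subgroup ?K G" using gc by (intro generate_is_subgroup) auto
  moreover have "one_product_free G (F + E)"
    using S unfolding eq by (rule one_product_free_mono) simp
  ultimately have "deficit (F + E) \<le> (int p - 1)\<^sup>2"
    using deficit_coset_block[of F E ?K] g(2) E by blast
  then show ?thesis using deficit_add[of "F + E" "?O + ?g"] S unfolding eq by linarith
qed

section \<open>Maximal cyclic subgroups of frequent terms\<close>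

lemma mem_of_le_count: "p \<le> count R v \<Longrightarrow> v \<in># R"
  using p_gt_1 by (auto intro: count_inI)

text \<open>Take a frequent \<open>g\<close> with the largest cyclic subgroup. A frequent
  \<open>v\<close> outside it then has \<open>g\<close> outside \<open>generate G {v}\<close>, so
  copies of \<open>g\<close> can spread the terms in that subgroup.\<close>

lemma ex_maximal_cyclic:
  assumes "set_mset R \<subseteq> carrier G" "\<exists>v. p \<le> count R v"
  obtains g where "p \<le> count R g"
    "\<And>v. p \<le> count R v \<Longrightarrow> g \<in> generate G {v} \<Longrightarrow> v \<in> generate G {g}"
proof -
  let ?V = "{v. p \<le> count R v}" and ?c = "\<lambda>v. card (generate G {v})"
  have finV: "finite ?V"
    by (rule finite_subset[of _ "set_mset R"]) (auto dest: mem_of_le_count)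
  then have "Max (?c ` ?V) \<in> ?c ` ?V" using assms(2) by (intro Max_in) auto
  then obtain g where g: "p \<le> count R g" "Max (?c ` ?V) = ?c g" by blast
  have "v \<in> generate G {g}" if v: "p \<le> count R v" "g \<in> generate G {v}" for v
  proof -
    have K: "subgroup (generate G {v}) G"
      using mem_of_le_count[OF v(1)] assms(1) by (intro generate_is_subgroup) auto
    have "generate G {g} \<subseteq> generate G {v}"
      using generate_subgroup_incl[OF _ K, of "{g}"] v(2) by simp
    moreover have "?c v \<le> ?c g" unfolding g(2)[symmetric] using v(1) finV by (intro Max_ge) auto
    moreover have "finite (generate G {v})"
      using finite_subset[OF subgroup.subset[OF K] finite_carrier] .
    ultimately have "generate G {g} = generate G {v}" by (simp add: card_seteq)
    then show ?thesis using generate.incl[of v "{v}" G] by simp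
  qed
  then show thesis using that g(1) by blast
qed

lemma size_le_of_low_multiplicity:
  assumes "\<And>v. count R v < p"
  shows "size R \<le> card (set_mset R) * (p - 1)"
proof -
  have "size R = (\<Sum>v\<in>set_mset R. count R v)" by (simp add: size_multiset_overloaded_eq)
  also have "\<dots> \<le> (\<Sum>v\<in>set_mset R. p - 1)"
  proof (rule sum_mono)
    show "count R v \<le> p - 1" for v using assms[of v] by linarith
  qed
  finally show ?thesis by simp
qed

lemma int_p_minus_1: "int (p - 1) = int p - 1"
  using p_gt_1 by (simp add: of_nat_diff)

lemma deficit_le_of_low_multiplicity:
  assumes "one_product_free G R" "\<And>v. count R v < p"
  shows "deficit R \<le> (int p - 1)\<^sup>2 * int (card (set_mset R))"
proof -
  have "int (size R) \<le> int (card (set_mset R)) * (int p - 1)"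
    using size_le_of_low_multiplicity[OF assms(2)] int_p_minus_1 by (metis of_nat_le_iff of_nat_mult)
  then have "(int p - 1) * int (size R) \<le> (int p - 1) * (int (card (set_mset R)) * (int p - 1))"
    using p_gt_1 by (intro mult_left_mono) auto
  then show ?thesis using deficit_le_size[OF assms(1)] by (simp add: power2_eq_square ac_simps)
qed

text \<open>The elements of a maximal cyclic subgroup \<open>\<langle>g\<rangle>\<close> are spread over \<open>p\<close> cosets by \<open>E\<close>, after
  which \<open>p - 1\<close> copies of \<open>g\<close> take over the role of \<open>E\<close> for the elements outside \<open>\<langle>g\<rangle>\<close>.\<close>

lemma deficit_chain:
  assumes "one_product_free G (R + E)" "size E = p - 1"
    and "\<And>v. p \<le> count R v \<Longrightarrow> set_mset E \<inter> generate G {v} = {}"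
  shows "deficit (R + E) \<le> (int p - 1)\<^sup>2 * (int (card (set_mset R)) + 1)"
  using assms
\<comment> \<open>Each round costs (p - 1)^2 and removes at least \<open>g\<close> from the distinct
  terms.\<close>
proof (induction "card (set_mset R)" arbitrary: R E rule: less_induct)
  case less
  note S = less.prems(1)
  have Rc: "set_mset R \<subseteq> carrier G" using one_product_free_carrier[OF S] by simp
  show ?case
  proof (cases "\<exists>v. p \<le> count R v")
    case False
    have "deficit R \<le> (int p - 1)\<^sup>2 * int (card (set_mset R))"
      using False by (intro deficit_le_of_low_multiplicity one_product_free_mono[OF S])
        (auto simp: not_le)
    \<comment> \<open>The \<open>p - 1\<close> terms of \<open>E\<close>, at cost
      \<open>p - 1\<close> each, account for the \<open>+ 1\<close> in the bound.\<close>
    moreover have "deficit E \<le> (int p - 1)\<^sup>2"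
      using deficit_le_size[OF one_product_free_mono[OF S], of E] less.prems(2) int_p_minus_1
      by (simp add: power2_eq_square)
    ultimately show ?thesis using deficit_add[OF S] by (simp add: algebra_simps)
  next
    case True
    obtain g where gc: "p \<le> count R g"
      and gmax: "\<And>v. p \<le> count R v \<Longrightarrow> g \<in> generate G {v} \<Longrightarrow> v \<in> generate G {g}"
      using ex_maximal_cyclic[OF Rc True] by blast
    have gR: "g \<in># R" by (rule mem_of_le_count[OF gc])
    let ?O = "filter_mset (\<lambda>x. x \<notin> generate G {g}) R" and ?g = "replicate_mset (p - 1) g"
    have gg: "g \<in> generate G {g}" by (simp add: generate.incl)
    have "deficit (R + E) \<le> (int p - 1)\<^sup>2 + deficit (?O + ?g)"
      using deficit_cyclic_block[OF S less.prems(2), of g] less.prems(3)[OF gc] gc by linarith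
    moreover have "deficit (?O + ?g) \<le> (int p - 1)\<^sup>2 * (int (card (set_mset ?O)) + 1)"
    proof (rule less.hyps)
      have "set_mset ?O \<subset> set_mset R" using gR gg by auto
      then show "card (set_mset ?O) < card (set_mset R)" by (intro psubset_card_mono) auto
      have "?g \<subseteq># filter_mset (\<lambda>x. x \<in> generate G {g}) R"
        using gc gg by (intro replicate_mset_subset_filter_mset) simp_all
      then have "?O + ?g \<subseteq># R"
        using multiset_partition[of R "\<lambda>x. x \<in> generate G {g}"]
        by (metis add.commute subset_mset.add_le_cancel_left)
      then have "?O + ?g \<subseteq># R + E" by (simp add: subset_mset.add_increasing2)
      then show "one_product_free G (?O + ?g)" by (rule one_product_free_mono[OF S])
      show "set_mset ?g \<inter> generate G {v} = {}" if "p \<le> count ?O v" for v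
      proof -
        have v: "v \<notin> generate G {g}" using mem_of_le_count[OF that] by simp
        then have "p \<le> count R v" using that by simp
        then show ?thesis using gmax v by (auto split: if_splits)
      qed
    qed simp
    moreover have "int (card (set_mset ?O)) + 1 \<le> int (card (set_mset R))"
    proof -
      have "set_mset ?O \<subset> set_mset R" using gR gg by auto
      then have "card (set_mset ?O) < card (set_mset R)" by (intro psubset_card_mono) auto
      then show ?thesis by linarith
    qed
    then have "(int p - 1)\<^sup>2 * (int (card (set_mset ?O)) + 1) \<le> (int p - 1)\<^sup>2 * int (card (set_mset R))"
      by (intro mult_left_mono) auto
    ultimately show ?thesis by (simp add: algebra_simps)
  qed
qed

text \<open>Noncyclicity makes \<open>generate G {g}\<close> proper, so \<open>R\<close> itself
  supplies the \<open>p - 1\<close> outside terms that start the chain.\<close>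

lemma deficit_le_card_set_mset:
  assumes S: "one_product_free G R" and nc: "\<not> cyclic_group G"
    and out: "\<And>K. subgroup K G \<Longrightarrow> K \<noteq> carrier G \<Longrightarrow> p - 1 \<le> size (filter_mset (\<lambda>x. x \<notin> K) R)"
  shows "deficit R \<le> (int p - 1)\<^sup>2 * (int (card (set_mset R)) + 1)"
proof (cases "\<exists>v. p \<le> count R v")
  case False
  have "deficit R \<le> (int p - 1)\<^sup>2 * int (card (set_mset R))"
    using False by (intro deficit_le_of_low_multiplicity S) (auto simp: not_le)
  then show ?thesis by (simp add: distrib_left add_increasing2)
next
  case True
  have Rc: "set_mset R \<subseteq> carrier G" using one_product_free_carrier[OF S] .
  obtain g where gc: "p \<le> count R g"
    and gmax: "\<And>v. p \<le> count R v \<Longrightarrow> g \<in> generate G {v} \<Longrightarrow> v \<in> generate G {g}"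
    using ex_maximal_cyclic[OF Rc True] by blast
  have gR: "g \<in># R" by (rule mem_of_le_count[OF gc])
  let ?K = "generate G {g}"
  have gcar: "g \<in> carrier G" using gR Rc by auto
  have gg: "g \<in> ?K" by (simp add: generate.incl)
  have "?K \<noteq> carrier G"
  proof
    assume "?K = carrier G"
    then have "carrier G = range (\<lambda>n::int. g [^] n)" using generate_pow[OF gcar] by (simp add: full_SetCompr_eq)
    then show False using nc gcar cyclic_group by blast
  qed
  moreover have "subgroup ?K G" using gcar by (intro generate_is_subgroup) auto
  ultimately obtain E where E: "E \<subseteq># filter_mset (\<lambda>x. x \<notin> ?K) R" "size E = p - 1"
    using out obtain_submultiset_of_size by metis
  have EK: "set_mset E \<inter> ?K = {}" using set_mset_mono[OF E(1)] by auto
  have ER: "E \<subseteq># R" using E(1) multiset_filter_subset subset_mset.order_trans by blast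
  have gE: "g \<notin># E" using EK gg by blast
  \<comment> \<open>Removing \<open>E\<close> keeps every copy of \<open>g\<close>; the extra first
    round is paid for by \<open>g\<close>, which is absent from \<open>?O\<close>.\<close>
  let ?R = "R - E"
  let ?O = "filter_mset (\<lambda>x. x \<notin> ?K) ?R" and ?g = "replicate_mset (p - 1) g"
  have eq: "?R + E = R" using ER by simp
  have "deficit R \<le> (int p - 1)\<^sup>2 + deficit (?O + ?g)"
    using deficit_cyclic_block[of ?R E g] gc gE S EK E(2) unfolding eq
    by (simp add: not_in_iff)
  moreover have "deficit (?O + ?g) \<le> (int p - 1)\<^sup>2 * (int (card (set_mset ?O)) + 1)"
  proof (rule deficit_chain)
    have "?g \<subseteq># filter_mset (\<lambda>x. x \<in> ?K) ?R"
      using gc gg gE by (intro replicate_mset_subset_filter_mset) (simp_all add: not_in_iff)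
    then have "?O + ?g \<subseteq># ?R"
      using multiset_partition[of ?R "\<lambda>x. x \<in> ?K"]
      by (metis add.commute subset_mset.add_le_cancel_left)
    then have "?O + ?g \<subseteq># R" using diff_subset_eq_self subset_mset.order_trans by blast
    then show "one_product_free G (?O + ?g)" by (rule one_product_free_mono[OF S])
    show "set_mset ?g \<inter> generate G {v} = {}" if "p \<le> count ?O v" for v
    proof -
      have v: "v \<notin> ?K" using mem_of_le_count[OF that] by (auto dest: in_diffD)
      then have "p \<le> count R v" using that by simp
      then show ?thesis using gmax v by (auto split: if_splits)
    qed
  qed simp
  moreover have "card (set_mset ?O) < card (set_mset R)"
  proof (rule psubset_card_mono)
    have "g \<notin># ?O" "set_mset ?O \<subseteq> set_mset R" using gg by (auto dest: in_diffD)
    then show "set_mset ?O \<subset> set_mset R" using gR by blast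
  qed simp
  then have "(int p - 1)\<^sup>2 * (int (card (set_mset ?O)) + 1) \<le> (int p - 1)\<^sup>2 * int (card (set_mset R))"
    by (intro mult_left_mono) auto
  ultimately show ?thesis by (simp add: algebra_simps)
qed


section \<open>Moving terms that enlarge the product set\<close>

lemma one_notin_one_product_free: "one_product_free G S \<Longrightarrow> \<one> \<notin># S"
  using one_product_free_list[of S "[\<one>]"] by (auto simp: list_product_def)

text \<open>If distinct, \<open>x\<close> and \<open>inv x\<close> form a one-product; so
  \<open>x\<close> is an involution, which \<open>subgroup_mem_of_small_power\<close> with the
  trivial subgroup excludes for p > 2.\<close>

lemma one_product_free_inv_mem_imp_p_eq_2:
  assumes S: "one_product_free G S" and x: "x \<in># S" "inv x \<in># S"
  shows "p = 2"
proof -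
  have xc: "x \<in> carrier G" using one_product_free_carrier[OF S] x(1) by blast
  have x1: "x \<noteq> \<one>" using one_notin_one_product_free[OF S] x(1) by blast
  have eq: "inv x = x"
  proof (rule ccontr)
    assume "inv x \<noteq> x"
    then have "mset [x, inv x] \<subseteq># S" using x by (simp add: insert_subset_eq_iff in_diff_count)
    moreover have "list_product G [x, inv x] = \<one>" using xc by (simp add: list_product_def)
    ultimately show False using one_product_free_list[OF S] by blast
  qed
  then have "x [^] (2::nat) = \<one>" using r_inv[OF xc] xc by (simp add: numeral_2_eq_2)
  then have "\<not> 2 < p"
    using subgroup_mem_of_small_power[OF triv_subgroup xc, of 2] x1 by auto
  then show ?thesis using p_gt_1 by linarith
qed

text \<open>For \<open>p \<ge> 3\<close> the inverses double the number of available translations; for \<open>p = 2\<close> all terms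
  may be involutions, but then \<open>8p \<ge> 16(p - 1)\<close> already suffices.\<close>

lemma ex_large_growth:
  assumes S: "one_product_free G (U + R)" and R: "8 * p \<le> card (set_mset R)"
    and gen: "\<And>K. subgroup K G \<Longrightarrow> set_mset R \<subseteq> K \<Longrightarrow> K = carrier G"
    and U: "2 * p \<le> card (subprods G U)"
  shows "\<exists>x\<in>#R. card (subprods G U) + p \<le> card (subprods G (add_mset x U))"
proof -
  let ?B = "subprods G U" and ?r = "set_mset R"
  let ?T = "insert \<one> (?r \<union> m_inv G ` ?r)"
  have Uc: "set_mset U \<subseteq> carrier G" and Rc: "?r \<subseteq> carrier G"
    using one_product_free_carrier[OF S] by auto
  have B: "?B \<subseteq> carrier G" by (rule subprods_carrier[OF Uc])
  have finB: "finite ?B" by (rule finite_subset[OF B finite_carrier])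
  have RS: "one_product_free G R" by (rule one_product_free_mono[OF S]) simp
  have one: "\<one> \<notin> ?r" by (rule one_notin_one_product_free[OF RS])
  have inj: "inj_on (m_inv G) ?r" by (rule inj_onI) (metis Rc inv_inv subsetD)
  \<comment> \<open>An inverse of a term of \<open>R\<close> inside \<open>?B\<close> would complete
    a one-product. These inverses make the complement of \<open>?B\<close> large enough.\<close>
  have "m_inv G ` ?r \<subseteq> carrier G - ?B"
  proof clarify
    fix x assume x: "x \<in># R"
    then have xc: "x \<in> carrier G" using Rc by blast
    have "inv x \<notin> ?B"
    proof
      assume "inv x \<in> ?B"
      then have "inv x = \<one>"
        using one_product_free_mult_eq_one[OF S _ subprods_mem[OF x xc]] xc by simp
      then show False using one x xc by (metis inv_inv inv_one)
    qed
    then show "inv x \<in> carrier G - ?B" using xc by simp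
  qed
  then have "card (m_inv G ` ?r) \<le> card (carrier G - ?B)"
    using finite_carrier by (intro card_mono) auto
  then have "2 * (p - 1) < card (carrier G - ?B)"
    using card_image[OF inj] R p_gt_1 by linarith
  moreover have "16 * (p - 1) \<le> card ?T"
  proof (cases "p = 2")
    case True
    have "card ?r \<le> card ?T" by (intro card_mono) auto
    then show ?thesis using True R by simp
  next
    case False
    then have "?r \<inter> m_inv G ` ?r = {}"
      using one_product_free_inv_mem_imp_p_eq_2[OF RS] Rc by auto
    then have "card (?r \<union> m_inv G ` ?r) = card ?r + card (m_inv G ` ?r)"
      by (intro card_Un_disjoint) auto
    moreover have "card (?r \<union> m_inv G ` ?r) \<le> card ?T" by (intro card_mono) auto
    ultimately show ?thesis using card_image[OF inj] R by linarith
  qed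
  moreover have "2 * (p - 1) < card ?B" "0 < p - 1" using U p_gt_1 by linarith+
  moreover have "inv x \<in> ?T" if "x \<in> ?T" for x using that Rc by auto
  moreover have "?T \<subseteq> carrier G" using Rc by auto
  moreover have "K = carrier G" if "subgroup K G" "?T \<subseteq> K" for K using gen that by blast
  ultimately obtain x where x: "x \<in> ?T" "p - 1 < displacement G ?B x"
    using ex_large_displacement[OF finite_carrier B, of ?T "p - 1"] by blast
  \<comment> \<open>The translation found may be the inverse of a term, which has the same
    displacement.\<close>
  have "\<exists>y\<in>#R. p - 1 < displacement G ?B y"
  proof -
    have "x \<noteq> \<one>" using x(2) B by auto
    then consider "x \<in> ?r" | y where "y \<in># R" "x = inv y" using x(1) by auto
    then show ?thesis
    proof cases
      case 2
      then have "displacement G ?B x = displacement G ?B y"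
        using displacement_inv[OF finB B, of y] Rc by blast
      then show ?thesis using x(2) 2(1) by auto
    qed (use x in blast)
  qed
  then obtain y where y: "y \<in># R" "p - 1 < displacement G ?B y" by blast
  have yc: "y \<in> carrier G" using y(1) Rc by blast
  have Uyc: "set_mset (U + {#y#}) \<subseteq> carrier G" using Uc yc by simp
  have "?B \<union> (\<lambda>b. b \<otimes> y) ` ?B \<subseteq> subprods G (U + {#y#})"
    using subprods_mono[of U "U + {#y#}"] subprods_mult[OF Uyc, of _ y] subprods_mem[of y "{#y#}"] yc
    by auto
  then have "card (?B \<union> (\<lambda>b. b \<otimes> y) ` ?B) \<le> card (subprods G (U + {#y#}))"
    using finite_subset[OF subprods_carrier[OF Uyc] finite_carrier] by (intro card_mono) auto
  then have "card ?B + p \<le> card (subprods G (add_mset y U))"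
    using card_Un_shift[OF finB B yc] y(2) by simp
  then show ?thesis using y(1) by blast
qed

text \<open>While there are fewer than \<open>2p\<close> products, \<open>U\<close> has fewer than
  \<open>2p - 1\<close> terms, of cost at most \<open>p - 1\<close> each; hence the budget
  \<open>2p(p - 1)\<close>. Later each moved term gains \<open>p\<close> products, so the deficit of
  \<open>U\<close> does not rise.\<close>

lemma deficit_greedy:
  assumes S: "one_product_free G (U + R)" and nc: "\<not> cyclic_group G"
    and U: "deficit U \<le> 2 * int p * (int p - 1)"
    and out: "\<And>K. subgroup K G \<Longrightarrow> K \<noteq> carrier G \<Longrightarrow> p - 1 \<le> size (filter_mset (\<lambda>x. x \<notin> K) R)"
  shows "deficit (U + R) \<le> 2 * int p * (int p - 1) + 8 * int p * (int p - 1)\<^sup>2"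
  using S U out
proof (induction "size R" arbitrary: U R rule: less_induct)
  case less
  note S = less.prems(1)
  have RS: "one_product_free G R" and US: "one_product_free G U"
    by (rule one_product_free_mono[OF S], simp)+
  have sum: "deficit (U + R) \<le> deficit U + deficit R" by (rule deficit_add[OF S])
  txt \<open>Removing one term from \<open>R\<close> lowers the number of terms outside \<open>K\<close> by at most one, so the
    value \<open>p - 1\<close> cannot be skipped.\<close>
  consider (tight) K where "subgroup K G" "K \<noteq> carrier G" "size (filter_mset (\<lambda>x. x \<notin> K) R) = p - 1"
    | (few) "card (set_mset R) < 8 * p"
    | (grow) "8 * p \<le> card (set_mset R)"
      "\<And>K. subgroup K G \<Longrightarrow> K \<noteq> carrier G \<Longrightarrow> p \<le> size (filter_mset (\<lambda>x. x \<notin> K) R)"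
  proof (cases "\<exists>K. subgroup K G \<and> K \<noteq> carrier G \<and> size (filter_mset (\<lambda>x. x \<notin> K) R) = p - 1")
    case True
    then show ?thesis using tight by blast
  next
    case False
    have "p \<le> size (filter_mset (\<lambda>x. x \<notin> K) R)" if "subgroup K G" "K \<noteq> carrier G" for K
    proof -
      have "size (filter_mset (\<lambda>x. x \<notin> K) R) \<noteq> p - 1" using False that by blast
      then show ?thesis using less.prems(3)[OF that] by linarith
    qed
    then show ?thesis using few grow by (cases "card (set_mset R) < 8 * p") (auto simp: not_less)
  qed
  then show ?case
  proof cases
    case tight
    have "deficit R \<le> (int p - 1)\<^sup>2"
      using deficit_coset_block[of "filter_mset (\<lambda>x. x \<in> K) R" "filter_mset (\<lambda>x. x \<notin> K) R" K] RS tight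
      by auto
    moreover have "1 * (int p - 1)\<^sup>2 \<le> 8 * int p * (int p - 1)\<^sup>2"
      using p_gt_1 by (intro mult_right_mono) auto
    ultimately show ?thesis using sum less.prems(2) by linarith
  next
    case few
    have "deficit R \<le> (int p - 1)\<^sup>2 * (int (card (set_mset R)) + 1)"
      by (rule deficit_le_card_set_mset[OF RS nc less.prems(3)])
    \<comment> \<open>The strict bound on the number of distinct terms absorbs the
      \<open>+ 1\<close>.\<close>
    moreover have "(int p - 1)\<^sup>2 * (int (card (set_mset R)) + 1) \<le> (int p - 1)\<^sup>2 * (8 * int p)"
      using few by (intro mult_left_mono) auto
    ultimately show ?thesis using sum less.prems(2) by (simp add: mult.commute)
  next
    case grow
    have "\<exists>x\<in>#R. deficit (add_mset x U) \<le> 2 * int p * (int p - 1)"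
    proof (cases "2 * p \<le> card (subprods G U)")
      case True
      have "K = carrier G" if "subgroup K G" "set_mset R \<subseteq> K" for K
      proof (rule ccontr)
        assume "K \<noteq> carrier G"
        then have "p \<le> size (filter_mset (\<lambda>x. x \<notin> K) R)" using grow(2) that(1) by blast
        moreover have "filter_mset (\<lambda>x. x \<notin> K) R = {#}" using that(2) by auto
        ultimately show False using p_gt_1 by simp
      qed
      from ex_large_growth[OF S grow(1) this True]
      obtain x where x: "x \<in># R" "card (subprods G U) + p \<le> card (subprods G (add_mset x U))"
        by blast
      then have "deficit (add_mset x U) \<le> deficit U" by (simp add: deficit_def algebra_simps)
      then have "deficit (add_mset x U) \<le> 2 * int p * (int p - 1)" using less.prems(2) by linarith
      then show ?thesis using x(1) by blast
    next
      case False
      have "R \<noteq> {#}" using grow(1) p_gt_1 by auto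
      then obtain x where x: "x \<in># R" by blast
      then have "add_mset x U \<subseteq># U + R" by simp
      then have "one_product_free G (add_mset x U)" by (rule one_product_free_mono[OF S])
      then have "deficit (add_mset x U) \<le> (int p - 1) * int (size (add_mset x U))"
        by (rule deficit_le_size)
      moreover have "(int p - 1) * int (size (add_mset x U)) \<le> (int p - 1) * (2 * int p)"
        using size_less_card_subprods[OF finite_carrier US] False p_gt_1
        by (intro mult_left_mono) auto
      ultimately have "deficit (add_mset x U) \<le> 2 * int p * (int p - 1)"
        by (simp only: mult.commute[of "int p - 1" "2 * int p"])
      then show ?thesis using x by blast
    qed
    then obtain x where x: "x \<in># R" "deficit (add_mset x U) \<le> 2 * int p * (int p - 1)" by blast
    have eq: "add_mset x U + (R - {#x#}) = U + R" using x(1) by simp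
    have "deficit (add_mset x U + (R - {#x#})) \<le> 2 * int p * (int p - 1) + 8 * int p * (int p - 1)\<^sup>2"
    proof (rule less.hyps)
      show "size (R - {#x#}) < size R" by (rule size_Diff1_less[OF x(1)])
      show "one_product_free G (add_mset x U + (R - {#x#}))" unfolding eq by (rule S)
      show "p - 1 \<le> size (filter_mset (\<lambda>y. y \<notin> K) (R - {#x#}))"
        if "subgroup K G" "K \<noteq> carrier G" for K
        using grow(2)[OF that] by (cases "x \<in> K") (auto simp: size_Diff_singleton_if)
    qed (rule x(2))
    then show ?thesis unfolding eq .
  qed
qed

section \<open>Index of proper subgroups and the length bound\<close>

lemma mult_card_proper_subgroup_le:
  assumes K: "subgroup K G" "K \<noteq> carrier G"
  shows "p * card K \<le> Coset.order G"
proof -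
  let ?i = "card (rcosets K)"
  have lag: "?i * card K = Coset.order G" by (rule lagrange[OF K(1)])
  have "?i \<noteq> 1"
  proof
    assume "?i = 1"
    then have "card K = card (carrier G)" using lag by (simp add: Coset.order_def)
    then show False using card_subset_eq[OF finite_carrier subgroup.subset[OF K(1)]] K(2) by simp
  qed
  then obtain q where q: "Factorial_Ring.prime q" "q dvd ?i" using prime_factor_nat by blast
  have "0 < Coset.order G" using finite_carrier order_gt_0_iff_finite by simp
  then have "0 < ?i" using lag by (metis gr0I mult_0 less_irrefl)
  moreover have "q dvd Coset.order G" using q(2) lag by (metis dvd_mult2)
  ultimately have "p \<le> ?i" using p_le[OF q(1)] dvd_imp_le[OF q(2)] by linarith
  then have "p * card K \<le> ?i * card K" by (rule mult_le_mono1)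
  then show ?thesis using lag by simp
qed

text \<open>Multiplying by \<open>p\<close> over the integers avoids division and truncated
  subtraction.\<close>

lemma size_one_product_free_le:
  assumes S: "one_product_free G S" and nc: "\<not> cyclic_group G"
  shows "int p * int (size S) \<le> int (Coset.order G) + int p * (9 * (int p)\<^sup>2 - 10 * int p)"
proof (cases "\<exists>K. subgroup K G \<and> K \<noteq> carrier G \<and> size (filter_mset (\<lambda>x. x \<notin> K) S) < p - 1")
  case True
  then obtain K where K: "subgroup K G" "K \<noteq> carrier G"
    "size (filter_mset (\<lambda>x. x \<notin> K) S) < p - 1" by blast
  let ?A = "filter_mset (\<lambda>x. x \<in> K) S"
  have "size ?A < card (subprods G ?A)"
    by (rule size_less_card_subprods[OF finite_carrier one_product_free_mono[OF S]]) simp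
  also have "\<dots> \<le> card K"
    using finite_subset[OF subgroup.subset[OF K(1)] finite_carrier] subprods_subgroup[OF K(1), of ?A]
    by (intro card_mono) auto
  finally have "size S \<le> card K + p"
    using K(3) by (subst multiset_partition[of S "\<lambda>x. x \<in> K"], subst size_union) linarith
  then have "p * size S \<le> p * card K + p * p"
    using mult_le_mono2[of "size S" "card K + p" p] by (simp add: distrib_left)
  then have "p * size S \<le> Coset.order G + p * p" using mult_card_proper_subgroup_le[OF K(1,2)] by linarith
  then have "int p * int (size S) \<le> int (Coset.order G) + int p * int p"
    by (metis of_nat_add of_nat_le_iff of_nat_mult)
  moreover have "2 * int p \<le> int p * int p" using p_gt_1 by (intro mult_right_mono) auto
  then have "int p \<le> 9 * (int p)\<^sup>2 - 10 * int p" unfolding power2_eq_square by linarith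
  ultimately show ?thesis using mult_left_mono[of "int p" "9 * (int p)\<^sup>2 - 10 * int p" "int p"] by simp
next
  case False
  have "deficit {#} \<le> 0" using deficit_le_size[of "{#}"] by (simp add: one_product_free_def)
  moreover have "0 \<le> 2 * int p * (int p - 1)" using p_gt_1 by simp
  ultimately have "deficit S \<le> 2 * int p * (int p - 1) + 8 * int p * (int p - 1)\<^sup>2"
    using deficit_greedy[of "{#}" S] S nc False by (auto simp: not_less)
  moreover have "card (subprods G S) \<le> Coset.order G"
    using card_mono[OF finite_carrier subprods_carrier[OF one_product_free_carrier[OF S]]]
    by (simp add: Coset.order_def)
  ultimately have "int p * int (size S)
      \<le> int (Coset.order G) + (2 * int p * (int p - 1) + 8 * int p * (int p - 1)\<^sup>2)"
    by (simp add: deficit_def)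
  \<comment> \<open>The slack against the claimed bound is \<open>p\<close> times p^2 + 4p - 6,
    which is nonnegative for p >= 2.\<close>
  moreover have "2 * int p * (int p - 1) + 8 * int p * (int p - 1)\<^sup>2
      = int p * (9 * (int p)\<^sup>2 - 10 * int p - ((int p)\<^sup>2 + 4 * int p - 6))"
    by (simp add: power2_eq_square algebra_simps)
  moreover have "0 \<le> (int p)\<^sup>2 + 4 * int p - 6"
    using p_gt_1 zero_le_power2[of "int p"] by linarith
  then have "int p * (9 * (int p)\<^sup>2 - 10 * int p - ((int p)\<^sup>2 + 4 * int p - 6))
      \<le> int p * (9 * (int p)\<^sup>2 - 10 * int p)"
    by (intro mult_left_mono) auto
  ultimately show ?thesis by linarith
qed

end

theorem theorem1p1:
  fixes G :: "('a, 'b) monoid_scheme" and n p :: nat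
  assumes "Group.group G" and "finite (carrier G)" and "\<not> cyclic_group G"
    and "n = Coset.order G"
    and "Factorial_Ring.prime p" and "p dvd n"
    and "\<And>q::nat. Factorial_Ring.prime q \<Longrightarrow> q dvd n \<Longrightarrow> p \<le> q"
  shows "real (small_davenport G) \<le> real n / real p + 9 * (real p)\<^sup>2 - 10 * real p"
proof -
  interpret group G by (rule assms(1))
  have p1: "1 < p" by (rule prime_gt_1_nat[OF assms(5)])
  interpret least_prime_group G p
    by unfold_locales (use assms(2,4,7) p1 in auto)
  have "small_davenport G \<in> {size S |S. one_product_free G S}"
    unfolding small_davenport_def by (rule Max_in) (rule one_product_free_lengths[OF assms(2)])+
  then obtain S where S: "one_product_free G S" "small_davenport G = size S" by blast
  have "real_of_int (int p * int (size S))
      \<le> real_of_int (int (Coset.order G) + int p * (9 * (int p)\<^sup>2 - 10 * int p))"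
    using size_one_product_free_le[OF S(1) assms(3)] by (simp only: of_int_le_iff)
  then have "real p * real (size S) \<le> real n + real p * (9 * (real p)\<^sup>2 - 10 * real p)"
    using assms(4) by simp
  then have "real (size S) \<le> (real n + real p * (9 * (real p)\<^sup>2 - 10 * real p)) / real p"
    using p1 by (simp add: le_divide_eq mult.commute)
  also have "\<dots> = real n / real p + 9 * (real p)\<^sup>2 - 10 * real p"
    using p1 by (simp add: add_divide_distrib)
  finally show ?thesis using S(2) by simp
qed

end
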